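(* Let $Z\colon \Theta \to (0,\infty)$ and $\widetilde{Z} \colon \Theta \to (0,\infty)$ be measurable functions with $C_Z, C_{\widetilde Z}\in(0,\infty)$, and let $\pi_Z$ and $\pi_{\widetilde Z}$ be the associated probability measures on $\Theta$. Suppose that for some $p\in[1,\infty]$ we have $\Vert \exp(-\Phi)/ Z \Vert_{\mu,p} \leq K$ for some $K <\infty$. Then $$ \left\Vert \pi_Z - \pi_{\widetilde{Z}} \right\Vert_{\rm tv} \leq \frac{2K}{C_{Z}} \left\Vert \frac{Z}{\widetilde Z} - 1 \right\Vert_{\mu,p/(p-1)}. $$ If additionally $\inf_{\theta\in \Theta} \widetilde Z(\theta) \geq \ell$ for some $\ell>0$, then $$ \left\Vert \pi_Z - \pi_{\widetilde{Z}} \right\Vert_{\rm tv} \leq \frac{2K}{\ell C_{Z}} \left\Vert Z - \widetilde Z \right\Vert_{\mu,p/(p-1)}. $$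
   Context: $(\Theta,d)$ is a complete separable metric space with Borel $\sigma$-algebra $\mathcal{B}(\Theta)$ and a $\sigma$-finite reference measure $\mu$; $\Phi\colon\Theta\to(-\infty,\infty)$ is a fixed measurable function. For measurable $Z\colon\Theta\to(0,\infty)$ set $C_Z := \int_\Theta \frac{\exp(-\Phi(\theta))}{Z(\theta)}\,\mu(\mathrm{d}\theta)$, and if $C_Z\in(0,\infty)$ define the probability measure $\pi_Z(A) := \frac{1}{C_Z}\int_A \frac{\exp(-\Phi(\theta))}{Z(\theta)}\,\mu(\mathrm{d}\theta)$ for $A\in\mathcal{B}(\Theta)$; similarly $C_{\widetilde Z}$ and $\pi_{\widetilde Z}$ for another measurable function $\widetilde Z\colon\Theta\to(0,\infty)$. For a measure $\nu$ on $(\Theta,\mathcal B(\Theta))$, $1\le p<\infty$ and measurable $f\colon\Theta\to\mathbb{R}$, $\Vert f\Vert_{\nu,p} := \left(\int_\Theta |f(\theta)|^p\,\nu(\mathrm{d}\theta)\right)^{1/p}\in[0,\infty]$; $\Vert f\Vert_{\nu,\infty}$ is the $\nu$-essential supremum of $|f|$. The exponent $p/(p-1)$ is the Hölder conjugate of $p$, read as $\infty$ for $p=1$ and as $1$ for $p=\infty$. Total variation distance (note the normalization): $\Vert \nu_1-\nu_2\Vert_{\rm tv} := \sup_{|f|_\infty\le 1}\left|\int f\,\mathrm{d}\nu_1-\int f\,\mathrm{d}\nu_2\right|$, the supremum being over measurable $f\colon\Theta\to\mathbb{R}$ with $|f|_\infty := \sup_{\theta\in\Theta}|f(\theta)|\le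 1$. *)

theory Defs
  imports "HOL-Probability.Probability"
begin

definition normconst :: "'a measure \<Rightarrow> ('a \<Rightarrow> real) \<Rightarrow> ('a \<Rightarrow> real) \<Rightarrow> ennreal" where
  "normconst \<mu> \<Phi> Z = (\<integral>\<^sup>+ \<theta>. ennreal (exp (- \<Phi> \<theta>) / Z \<theta>) \<partial>\<mu>)"

text \<open>Meaningful only when the normalizing constant lies strictly between 0 and infinity.\<close>

definition posterior :: "'a measure \<Rightarrow> ('a \<Rightarrow> real) \<Rightarrow> ('a \<Rightarrow> real) \<Rightarrow> 'a measure" where
  "posterior \<mu> \<Phi> Z =
     scale_measure (1 / normconst \<mu> \<Phi> Z) (density \<mu> (\<lambda>\<theta>. ennreal (exp (- \<Phi> \<theta>) / Z \<theta>)))"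

lemma emeasure_posterior:
  assumes "\<Phi> \<in> borel_measurable \<mu>" "Z \<in> borel_measurable \<mu>" "A \<in> sets \<mu>"
  shows "emeasure (posterior \<mu> \<Phi> Z) A =
    1 / normconst \<mu> \<Phi> Z * (\<integral>\<^sup>+ \<theta>\<in>A. ennreal (exp (- \<Phi> \<theta>) / Z \<theta>) \<partial>\<mu>)"
proof -
  have "(\<lambda>\<theta>. ennreal (exp (- \<Phi> \<theta>) / Z \<theta>)) \<in> borel_measurable \<mu>"
    using assms by measurable
  then show ?thesis
    using assms by (simp add: posterior_def emeasure_density)
qed

lemma prob_space_posterior:
  assumes "\<Phi> \<in> borel_measurable \<mu>" "Z \<in> borel_measurable \<mu>"
    and "0 < normconst \<mu> \<Phi> Z" "normconst \<mu> \<Phi> Z < \<infinity>"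
  shows "prob_space (posterior \<mu> \<Phi> Z)"
proof (rule prob_spaceI)
  have "(\<integral>\<^sup>+ \<theta>\<in>space \<mu>. ennreal (exp (- \<Phi> \<theta>) / Z \<theta>) \<partial>\<mu>) = normconst \<mu> \<Phi> Z"
    unfolding normconst_def by (rule nn_integral_cong) simp
  moreover have "1 / normconst \<mu> \<Phi> Z * normconst \<mu> \<Phi> Z = 1"
    using assms(3,4) by (simp add: ennreal_divide_times ennreal_divide_self)
  moreover have "space (posterior \<mu> \<Phi> Z) = space \<mu>"
    by (simp add: posterior_def space_scale_measure)
  ultimately show "emeasure (posterior \<mu> \<Phi> Z) (space (posterior \<mu> \<Phi> Z)) = 1"
    using emeasure_posterior[OF assms(1,2) sets.top] by simp
qed

text \<open>Real powers on the extended half-line, intended for positive exponents \<open>r\<close> only.\<close>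

definition ennpowr :: "ennreal \<Rightarrow> real \<Rightarrow> ennreal" where
  "ennpowr x r = (if x = \<infinity> then \<infinity> else ennreal (enn2real x powr r))"

definition Lp_norm :: "'a measure \<Rightarrow> ennreal \<Rightarrow> ('a \<Rightarrow> real) \<Rightarrow> ennreal" where
  "Lp_norm \<nu> p f =
    (if p = \<infinity> then esssup \<nu> (\<lambda>\<theta>. ennreal \<bar>f \<theta>\<bar>)
     else ennpowr (\<integral>\<^sup>+ \<theta>. ennreal (\<bar>f \<theta>\<bar> powr enn2real p) \<partial>\<nu>) (1 / enn2real p))"

definition holder_conj :: "ennreal \<Rightarrow> ennreal" where
  "holder_conj p = (if p = 1 then \<infinity> else if p = \<infinity> then 1 else p / (p - 1))"

text \<open>
  For probability measures this normalization is twice the supremum of the differences over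
  Borel sets. Intended for finite Borel measures, where all the integrals exist.
\<close>

definition tv_dist :: "'a::topological_space measure \<Rightarrow> 'a measure \<Rightarrow> ennreal" where
  "tv_dist \<nu>\<^sub>1 \<nu>\<^sub>2 =
    (SUP f \<in> {f \<in> borel_measurable borel. (SUP \<theta>. ennreal \<bar>f \<theta>\<bar>) \<le> 1}.
       ennreal \<bar>(\<integral>\<theta>. f \<theta> \<partial>\<nu>\<^sub>1) - (\<integral>\<theta>. f \<theta> \<partial>\<nu>\<^sub>2)\<bar>)"

end

theory Submission
  imports Defs
begin

text \<open>
  Write \<open>g = exp (-\<Phi>) / Z\<close> and \<open>h = exp (-\<Phi>) / Zt\<close> for the two unnormalized posterior densities,
  so that \<open>g\<close> has integral \<open>C\<close>, the normalizing constant of \<open>Z\<close>.  For a test function bounded by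
  one, the difference of the two posterior means is at most \<open>2 / C\<close> times the integral of
  \<open>\<bar>g - h\<bar>\<close>: one copy of this integral pays for exchanging the densities, the other one for
  exchanging the normalizing constants (\<open>normalized_integral_diff_le\<close>, \<open>tv_dist_posterior_le\<close>).

  The perturbation enters multiplicatively, \<open>\<bar>g - h\<bar> = g \<bar>Z / Zt - 1\<bar>\<close>, so Hoelder's inequality
  (\<open>Hoelder_inequality\<close>) separates the norm of \<open>g\<close>, bounded by \<open>K\<close>, from the conjugate norm of
  \<open>Z / Zt - 1\<close>.  When \<open>Zt\<close> is bounded below by \<open>l\<close>, the integrand is at most
  \<open>g \<bar>Z - Zt\<bar> / l\<close>, and the same inequality applied to \<open>Z - Zt\<close> gives the second estimate.
\<close>

section \<open>Hoelder's inequality on the extended half-line\<close>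

lemma ennpowr_ne_0: "0 < r \<Longrightarrow> x \<noteq> 0 \<Longrightarrow> ennpowr x r \<noteq> 0"
  by (cases x) (auto simp: ennpowr_def)

text \<open>
  Scaling both functions to norm one reduces the estimate to the pointwise inequality of Young.
  The scaling fails when one of the two norms is zero or infinite; a zero norm makes the product
  vanish almost everywhere, and otherwise the right-hand side is infinite.
\<close>

lemma Hoelder_inequality_real_exponents:
  fixes u v :: "'a \<Rightarrow> real"
  assumes [measurable]: "u \<in> borel_measurable M" "v \<in> borel_measurable M"
    and pq: "1 < p" "1 < q" "1 / p + 1 / q = 1"
  shows "(\<integral>\<^sup>+ x. ennreal (\<bar>u x\<bar> * \<bar>v x\<bar>) \<partial>M)
    \<le> ennpowr (\<integral>\<^sup>+ x. ennreal (\<bar>u x\<bar> powr p) \<partial>M) (1 / p)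
      * ennpowr (\<integral>\<^sup>+ x. ennreal (\<bar>v x\<bar> powr q) \<partial>M) (1 / q)"
    (is "_ \<le> ennpowr ?A _ * ennpowr ?B _")
proof -
  consider "?A = 0 \<or> ?B = 0" | "?A \<noteq> 0" "?B \<noteq> 0" "?A = \<infinity> \<or> ?B = \<infinity>"
    | "?A \<noteq> 0" "?B \<noteq> 0" "?A \<noteq> \<infinity>" "?B \<noteq> \<infinity>"
    by blast
  then show ?thesis
  proof cases
    case 1
    then have "AE x in M. ennreal (\<bar>u x\<bar> * \<bar>v x\<bar>) = 0"
    proof
      assume "?A = 0"
      then have "AE x in M. ennreal (\<bar>u x\<bar> powr p) = 0"
        by (subst (asm) nn_integral_0_iff_AE) auto
      then show ?thesis by eventually_elim simp
    next
      assume "?B = 0"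
      then have "AE x in M. ennreal (\<bar>v x\<bar> powr q) = 0"
        by (subst (asm) nn_integral_0_iff_AE) auto
      then show ?thesis by eventually_elim simp
    qed
    then have "(\<integral>\<^sup>+ x. ennreal (\<bar>u x\<bar> * \<bar>v x\<bar>) \<partial>M) = 0"
      by (subst nn_integral_0_iff_AE) auto
    then show ?thesis by simp
  next
    case 2
    have "ennpowr ?A (1 / p) \<noteq> 0" "ennpowr ?B (1 / q) \<noteq> 0"
      using 2(1,2) pq ennpowr_ne_0[of "1 / p" ?A] ennpowr_ne_0[of "1 / q" ?B] by simp_all
    moreover have "ennpowr ?A (1 / p) = \<top> \<or> ennpowr ?B (1 / q) = \<top>"
      using 2 by (auto simp: ennpowr_def)
    ultimately have "ennpowr ?A (1 / p) * ennpowr ?B (1 / q) = \<top>"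
      by (auto simp: ennreal_mult_eq_top_iff)
    then show ?thesis by simp
  next
    case 3
    define a where "a = enn2real ?A"
    define b where "b = enn2real ?B"
    have A: "?A = ennreal a" and B: "?B = ennreal b"
      unfolding a_def b_def using 3 by (auto simp: less_top)
    have "0 < a" "0 < b"
      using 3 by (auto simp: a_def b_def enn2real_positive_iff less_top zero_less_iff_neq_zero)
    \<comment> \<open>The norms of \<open>u\<close> and \<open>v\<close>, by which the functions are scaled.\<close>
    define \<alpha> where "\<alpha> = a powr (1 / p)"
    define \<beta> where "\<beta> = b powr (1 / q)"
    have pos: "0 < \<alpha>" "0 < \<beta>"
      using \<open>0 < a\<close> \<open>0 < b\<close> by (auto simp: \<alpha>_def \<beta>_def)
    have pow: "\<alpha> powr p = a" "\<beta> powr q = b"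
      using \<open>0 < a\<close> \<open>0 < b\<close> pq by (auto simp: \<alpha>_def \<beta>_def powr_powr)
    have young: "\<bar>u x\<bar> * \<bar>v x\<bar> \<le>
        \<alpha> * \<beta> / (p * a) * \<bar>u x\<bar> powr p + \<alpha> * \<beta> / (q * b) * \<bar>v x\<bar> powr q" for x
    proof -
      have "\<bar>u x\<bar> / \<alpha> * (\<bar>v x\<bar> / \<beta>) \<le> (\<bar>u x\<bar> / \<alpha>) powr p / p + (\<bar>v x\<bar> / \<beta>) powr q / q"
        using pq pos by (intro Youngs_inequality) auto
      also have "\<dots> = \<bar>u x\<bar> powr p / (p * a) + \<bar>v x\<bar> powr q / (q * b)"
        using pos by (simp add: powr_divide pow mult.commute)
      finally have "(\<alpha> * \<beta>) * (\<bar>u x\<bar> / \<alpha> * (\<bar>v x\<bar> / \<beta>))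
          \<le> (\<alpha> * \<beta>) * (\<bar>u x\<bar> powr p / (p * a) + \<bar>v x\<bar> powr q / (q * b))"
        using pos by (intro mult_left_mono) auto
      then show ?thesis
        using pos by (simp add: distrib_left)
    qed
    have "(\<integral>\<^sup>+ x. ennreal (\<bar>u x\<bar> * \<bar>v x\<bar>) \<partial>M)
        \<le> (\<integral>\<^sup>+ x. ennreal (\<alpha> * \<beta> / (p * a)) * ennreal (\<bar>u x\<bar> powr p)
              + ennreal (\<alpha> * \<beta> / (q * b)) * ennreal (\<bar>v x\<bar> powr q) \<partial>M)"
      using young pos pq \<open>0 < a\<close> \<open>0 < b\<close>
      by (intro nn_integral_mono) (simp flip: ennreal_mult ennreal_plus)
    also have "\<dots> = ennreal (\<alpha> * \<beta> / (p * a)) * ?A + ennreal (\<alpha> * \<beta> / (q * b)) * ?B"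
      by (simp add: nn_integral_add nn_integral_cmult)
    also have "\<dots> = ennreal (\<alpha> * \<beta> * (1 / p + 1 / q))"
      using pos pq(1,2) \<open>0 < a\<close> \<open>0 < b\<close>
      by (simp add: A B distrib_left flip: ennreal_mult ennreal_plus)
    also have "\<dots> = ennreal \<alpha> * ennreal \<beta>"
      using pos by (simp add: pq ennreal_mult)
    also have "\<dots> = ennpowr ?A (1 / p) * ennpowr ?B (1 / q)"
      using \<open>0 < a\<close> \<open>0 < b\<close> by (simp add: A B ennpowr_def \<alpha>_def \<beta>_def)
    finally show ?thesis .
  qed
qed

lemma Lp_norm_1: "Lp_norm M 1 f = (\<integral>\<^sup>+ x. ennreal \<bar>f x\<bar> \<partial>M)"
  by (cases "\<integral>\<^sup>+ x. ennreal \<bar>f x\<bar> \<partial>M") (auto simp: Lp_norm_def ennpowr_def)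

text \<open>
  The end-point case is stated with the essentially bounded factor second; the exponent \<open>\<infinity>\<close> for the
  first factor follows by exchanging the two functions.
\<close>

lemma Hoelder_inequality_1_infinity:
  fixes u v :: "'a \<Rightarrow> real"
  assumes [measurable]: "u \<in> borel_measurable M"
  shows "(\<integral>\<^sup>+ x. ennreal (\<bar>u x\<bar> * \<bar>v x\<bar>) \<partial>M) \<le> Lp_norm M 1 u * Lp_norm M \<infinity> v"
proof -
  have "AE x in M. ennreal \<bar>v x\<bar> \<le> Lp_norm M \<infinity> v"
    unfolding Lp_norm_def by (simp add: esssup_AE)
  then have "AE x in M. ennreal (\<bar>u x\<bar> * \<bar>v x\<bar>) \<le> ennreal \<bar>u x\<bar> * Lp_norm M \<infinity> v"
    by eventually_elim (simp add: ennreal_mult mult_left_mono)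
  then have "(\<integral>\<^sup>+ x. ennreal (\<bar>u x\<bar> * \<bar>v x\<bar>) \<partial>M) \<le> (\<integral>\<^sup>+ x. ennreal \<bar>u x\<bar> * Lp_norm M \<infinity> v \<partial>M)"
    by (rule nn_integral_mono_AE)
  also have "\<dots> = Lp_norm M 1 u * Lp_norm M \<infinity> v"
    by (simp add: nn_integral_multc Lp_norm_1)
  finally show ?thesis .
qed

lemma Hoelder_inequality:
  fixes u v :: "'a \<Rightarrow> real"
  assumes meas: "u \<in> borel_measurable M" "v \<in> borel_measurable M"
    and "1 \<le> p"
  shows "(\<integral>\<^sup>+ x. ennreal (\<bar>u x\<bar> * \<bar>v x\<bar>) \<partial>M) \<le> Lp_norm M p u * Lp_norm M (holder_conj p) v"
proof -
  consider "p = 1" | "p = \<infinity>" | "p \<noteq> 1" "p \<noteq> \<infinity>"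
    by blast
  then show ?thesis
  proof cases
    case 1
    then show ?thesis
      using Hoelder_inequality_1_infinity[OF meas(1)] by (simp add: holder_conj_def)
  next
    case 2
    then show ?thesis
      using Hoelder_inequality_1_infinity[OF meas(2), of u]
      by (simp add: holder_conj_def mult.commute)
  next
    case 3
    then obtain r where p: "p = ennreal r" and "0 \<le> r"
      by (cases p) auto
    then have "1 < r"
      using 3 \<open>1 \<le> p\<close> by (auto simp: less_le ennreal_1[symmetric] simp del: ennreal_1)
    have q: "holder_conj p = ennreal (r / (r - 1))"
    proof -
      have "p - 1 = ennreal (r - 1)"
        using ennreal_minus[of 1 r] by (simp add: p)
      then show ?thesis
        using 3 \<open>1 < r\<close> by (simp add: holder_conj_def p divide_ennreal)
    qed
    have "1 / r + 1 / (r / (r - 1)) = 1" "1 < r / (r - 1)"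
      using \<open>1 < r\<close> by (auto simp: field_simps)
    then show ?thesis
      using Hoelder_inequality_real_exponents[OF meas \<open>1 < r\<close>, of "r / (r - 1)"] \<open>1 < r\<close>
      unfolding q by (simp add: p Lp_norm_def)
  qed
qed

section \<open>Total variation between normalized densities\<close>

text \<open>
  Replacing the density \<open>v\<close> by \<open>u\<close> under the integral costs \<open>\<integral>\<bar>u - v\<bar>\<close>, relative to \<open>\<integral>u\<close>, and replacing the
  normalizing constant \<open>\<integral>v\<close> by \<open>\<integral>u\<close> costs the same amount again, since a function bounded
  by one has mean at most one under the normalized \<open>v\<close>.  Only the constant of \<open>u\<close> survives
  in the bound.
\<close>

lemma normalized_integral_diff_le:
  fixes u v f :: "'a \<Rightarrow> real"
  assumes int: "integrable M u" "integrable M v"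
    and nonneg: "\<And>x. 0 \<le> u x" "\<And>x. 0 \<le> v x"
    and pos: "0 < (\<integral>x. u x \<partial>M)" "0 < (\<integral>x. v x \<partial>M)"
    and f: "f \<in> borel_measurable M" "\<And>x. \<bar>f x\<bar> \<le> 1"
  shows "\<bar>(\<integral>x. u x * f x \<partial>M) / (\<integral>x. u x \<partial>M) - (\<integral>x. v x * f x \<partial>M) / (\<integral>x. v x \<partial>M)\<bar>
    \<le> 2 / (\<integral>x. u x \<partial>M) * (\<integral>x. \<bar>u x - v x\<bar> \<partial>M)"
proof -
  define a where "a = (\<integral>x. u x \<partial>M)"
  define b where "b = (\<integral>x. v x \<partial>M)"
  define d where "d = (\<integral>x. \<bar>u x - v x\<bar> \<partial>M)"
  have bounded_mult: "integrable M (\<lambda>x. w x * f x)" if "integrable M w" for w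
    by (rule Bochner_Integration.integrable_bound[OF that])
       (use that f in \<open>auto simp: abs_mult intro!: AE_I2 mult_left_le\<close>)
  note uf = bounded_mult[OF int(1)] and vf = bounded_mult[OF int(2)]
  have intd: "integrable M (\<lambda>x. \<bar>u x - v x\<bar>)"
    using int by auto
  have "\<bar>(\<integral>x. u x * f x \<partial>M) - (\<integral>x. v x * f x \<partial>M)\<bar> = \<bar>\<integral>x. (u x - v x) * f x \<partial>M\<bar>"
    using uf vf by (simp add: left_diff_distrib)
  also have "\<dots> \<le> (\<integral>x. \<bar>(u x - v x) * f x\<bar> \<partial>M)"
    by (rule integral_abs_bound)
  also have "\<dots> \<le> d"
    unfolding d_def using int f
    by (intro integral_mono integrable_abs bounded_mult intd) (auto simp: abs_mult intro: mult_left_le)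
  finally have 1: "\<bar>(\<integral>x. u x * f x \<partial>M) - (\<integral>x. v x * f x \<partial>M)\<bar> \<le> d" .
  have "\<bar>b - a\<bar> = \<bar>\<integral>x. v x - u x \<partial>M\<bar>"
    using int by (simp add: a_def b_def)
  also have "\<dots> \<le> (\<integral>x. \<bar>v x - u x\<bar> \<partial>M)"
    by (rule integral_abs_bound)
  finally have 2: "\<bar>b - a\<bar> \<le> d"
    by (simp add: d_def abs_minus_commute)
  have "\<bar>\<integral>x. v x * f x \<partial>M\<bar> \<le> (\<integral>x. \<bar>v x * f x\<bar> \<partial>M)"
    by (rule integral_abs_bound)
  also have "\<dots> \<le> b"
    unfolding b_def using int f nonneg
    by (intro integral_mono integrable_abs vf) (auto simp: abs_mult intro: mult_left_le)
  finally have 3: "\<bar>(\<integral>x. v x * f x \<partial>M) / b\<bar> \<le> 1"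
    using pos by (simp add: b_def)
  \<comment> \<open>Adding and subtracting \<open>(\<integral>v f) / a\<close> separates the change of density from the change of
    normalizing constant.\<close>
  have "(\<integral>x. u x * f x \<partial>M) / a - (\<integral>x. v x * f x \<partial>M) / b =
    (((\<integral>x. u x * f x \<partial>M) - (\<integral>x. v x * f x \<partial>M)) + (\<integral>x. v x * f x \<partial>M) / b * (b - a)) / a"
    using pos by (simp add: a_def b_def field_simps)
  also have "\<bar>\<dots>\<bar> \<le> (d + 1 * d) / a"
  proof -
    have "\<bar>(\<integral>x. v x * f x \<partial>M) / b * (b - a)\<bar> \<le> 1 * d"
      unfolding abs_mult using 2 3 by (intro mult_mono) auto
    with 1 show ?thesis
      using pos unfolding abs_divide
      by (intro divide_mono order_trans[OF abs_triangle_ineq] add_mono) (auto simp: a_def)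
  qed
  finally show ?thesis
    by (simp add: a_def b_def d_def)
qed

lemma posterior_eq_density:
  assumes "\<Phi> \<in> borel_measurable \<mu>" "Z \<in> borel_measurable \<mu>"
  shows "posterior \<mu> \<Phi> Z
    = density \<mu> (\<lambda>x. 1 / normconst \<mu> \<Phi> Z * ennreal (exp (- \<Phi> x) / Z x))"
  using assms
  by (intro measure_eqI)
     (auto simp: emeasure_posterior emeasure_density nn_integral_cmult mult.assoc posterior_def
        intro!: nn_integral_cmult[symmetric])

lemma integral_posterior:
  fixes f :: "'a \<Rightarrow> real"
  assumes [measurable]: "\<Phi> \<in> borel_measurable \<mu>" "Z \<in> borel_measurable \<mu>" "f \<in> borel_measurable \<mu>"
    and Z: "\<And>x. 0 < Z x"
    and C: "normconst \<mu> \<Phi> Z = ennreal c" "0 < c"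
  shows "(\<integral>x. f x \<partial>posterior \<mu> \<Phi> Z) = (\<integral>x. exp (- \<Phi> x) / Z x * f x \<partial>\<mu>) / c"
proof -
  have "1 / normconst \<mu> \<Phi> Z * ennreal (exp (- \<Phi> x) / Z x) = ennreal (exp (- \<Phi> x) / Z x / c)" for x
    using C Z[of x] divide_ennreal[of 1 c]
    by (simp flip: ennreal_mult)
  then have "(\<integral>x. f x \<partial>posterior \<mu> \<Phi> Z) = (\<integral>x. exp (- \<Phi> x) / Z x * f x / c \<partial>\<mu>)"
    using C Z by (simp add: posterior_eq_density integral_density less_imp_le)
  then show ?thesis
    by (simp only: integral_divide_zero)
qed

lemma normconst_finite_imp_integral:
  assumes [measurable]: "\<Phi> \<in> borel_measurable \<mu>" "Z \<in> borel_measurable \<mu>"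
    and Z: "\<And>x. 0 < Z x"
    and C: "0 < normconst \<mu> \<Phi> Z" "normconst \<mu> \<Phi> Z < \<infinity>"
  shows "integrable \<mu> (\<lambda>x. exp (- \<Phi> x) / Z x)"
    and "normconst \<mu> \<Phi> Z = ennreal (\<integral>x. exp (- \<Phi> x) / Z x \<partial>\<mu>)"
    and "0 < (\<integral>x. exp (- \<Phi> x) / Z x \<partial>\<mu>)"
proof -
  show 1: "integrable \<mu> (\<lambda>x. exp (- \<Phi> x) / Z x)"
    using C Z by (intro integrableI_nonneg) (auto simp: normconst_def less_imp_le)
  show 2: "normconst \<mu> \<Phi> Z = ennreal (\<integral>x. exp (- \<Phi> x) / Z x \<partial>\<mu>)"
    unfolding normconst_def using Z by (intro nn_integral_eq_integral 1) (auto simp: less_imp_le)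
  show "0 < (\<integral>x. exp (- \<Phi> x) / Z x \<partial>\<mu>)"
    using C(1) unfolding 2 by simp
qed

text \<open>
  Since the normalizing constants are finite and positive, all quantities are real, and the
  estimate for a single test function carries over to the supremum.
\<close>

lemma tv_dist_posterior_le:
  fixes \<mu> :: "'a::topological_space measure"
  assumes [measurable_cong]: "sets \<mu> = sets borel"
    and [measurable]: "\<Phi> \<in> borel_measurable borel"
      "Z \<in> borel_measurable borel" "Zt \<in> borel_measurable borel"
    and Z: "\<And>x. 0 < Z x" and Zt: "\<And>x. 0 < Zt x"
    and CZ: "0 < normconst \<mu> \<Phi> Z" "normconst \<mu> \<Phi> Z < \<infinity>"
    and CZt: "0 < normconst \<mu> \<Phi> Zt" "normconst \<mu> \<Phi> Zt < \<infinity>"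
  shows "tv_dist (posterior \<mu> \<Phi> Z) (posterior \<mu> \<Phi> Zt)
    \<le> 2 / normconst \<mu> \<Phi> Z * (\<integral>\<^sup>+ x. ennreal \<bar>exp (- \<Phi> x) / Z x - exp (- \<Phi> x) / Zt x\<bar> \<partial>\<mu>)"
    (is "_ \<le> ?R")
proof -
  have meas: "\<Phi> \<in> borel_measurable \<mu>" "Z \<in> borel_measurable \<mu>" "Zt \<in> borel_measurable \<mu>"
    by measurable
  note u = normconst_finite_imp_integral[OF meas(1,2) Z CZ]
  note v = normconst_finite_imp_integral[OF meas(1,3) Zt CZt]
  have "ennreal \<bar>(\<integral>x. f x \<partial>posterior \<mu> \<Phi> Z) - (\<integral>x. f x \<partial>posterior \<mu> \<Phi> Zt)\<bar> \<le> ?R"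
    if "f \<in> borel_measurable borel" and f1: "(SUP x. ennreal \<bar>f x\<bar>) \<le> 1" for f :: "'a \<Rightarrow> real"
  proof -
    have f [measurable]: "f \<in> borel_measurable \<mu>"
      using that(1) by measurable
    have bound: "\<bar>f x\<bar> \<le> 1" for x
      using f1 by (simp add: SUP_le_iff)
    let ?a = "\<integral>x. exp (- \<Phi> x) / Z x \<partial>\<mu>"
    let ?d = "\<integral>x. \<bar>exp (- \<Phi> x) / Z x - exp (- \<Phi> x) / Zt x\<bar> \<partial>\<mu>"
    have "\<bar>(\<integral>x. f x \<partial>posterior \<mu> \<Phi> Z) - (\<integral>x. f x \<partial>posterior \<mu> \<Phi> Zt)\<bar> \<le> 2 / ?a * ?d"
      unfolding integral_posterior[OF meas(1,2) f Z u(2,3)] integral_posterior[OF meas(1,3) f Zt v(2,3)]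
      by (rule normalized_integral_diff_le)
         (use u v Z Zt f bound in \<open>auto simp: less_imp_le\<close>)
    moreover have "?R = ennreal (2 / ?a * ?d)"
    proof -
      have "(\<integral>\<^sup>+ x. ennreal \<bar>exp (- \<Phi> x) / Z x - exp (- \<Phi> x) / Zt x\<bar> \<partial>\<mu>) = ennreal ?d"
        using u(1) v(1) by (intro nn_integral_eq_integral integrable_abs Bochner_Integration.integrable_diff) auto
      moreover have "2 / normconst \<mu> \<Phi> Z = ennreal (2 / ?a)"
        using divide_ennreal[of 2 ?a] u(3) by (simp add: u(2))
      ultimately show ?thesis
        using u(3) ennreal_mult[of "2 / ?a" ?d] by simp
    qed
    ultimately show ?thesis
      by (simp add: ennreal_leI)
  qed
  then show ?thesis
    unfolding tv_dist_def by (auto intro!: SUP_least)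
qed

section \<open>Stability of the posterior under perturbed normalizers\<close>

theorem corollary2p5:
  fixes \<mu> :: "'a::polish_space measure"
    and \<Phi> Z Zt :: "'a \<Rightarrow> real"
    and p K :: ennreal
  assumes "sigma_finite_measure \<mu>" and "sets \<mu> = sets borel"
    and "\<Phi> \<in> borel_measurable borel"
    and "Z \<in> borel_measurable borel" and "\<And>\<theta>. 0 < Z \<theta>"
    and "Zt \<in> borel_measurable borel" and "\<And>\<theta>. 0 < Zt \<theta>"
    and "0 < normconst \<mu> \<Phi> Z" and "normconst \<mu> \<Phi> Z < \<infinity>"
    and "0 < normconst \<mu> \<Phi> Zt" and "normconst \<mu> \<Phi> Zt < \<infinity>"
    and "1 \<le> p"
    and "K < \<infinity>"
    and "Lp_norm \<mu> p (\<lambda>\<theta>. exp (- \<Phi> \<theta>) / Z \<theta>) \<le> K"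
  shows "tv_dist (posterior \<mu> \<Phi> Z) (posterior \<mu> \<Phi> Zt)
           \<le> 2 * K / normconst \<mu> \<Phi> Z * Lp_norm \<mu> (holder_conj p) (\<lambda>\<theta>. Z \<theta> / Zt \<theta> - 1)
       \<and> (\<forall>l::real. 0 < l \<and> l \<le> (INF \<theta>. Zt \<theta>) \<longrightarrow>
            tv_dist (posterior \<mu> \<Phi> Z) (posterior \<mu> \<Phi> Zt)
              \<le> 2 * K / (ennreal l * normconst \<mu> \<Phi> Z)
                  * Lp_norm \<mu> (holder_conj p) (\<lambda>\<theta>. Z \<theta> - Zt \<theta>))"
proof (intro conjI allI impI)
  have [measurable_cong]: "sets \<mu> = sets borel"
    by fact
  have [measurable]: "\<Phi> \<in> borel_measurable borel" "Z \<in> borel_measurable borel"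
    "Zt \<in> borel_measurable borel"
    by fact+
  let ?g = "\<lambda>\<theta>. exp (- \<Phi> \<theta>) / Z \<theta>"
  let ?C = "normconst \<mu> \<Phi> Z"
  note tv = tv_dist_posterior_le[OF assms(2-4,6,5,7-11)]
  have Hoelder: "(\<integral>\<^sup>+ \<theta>. ennreal (\<bar>?g \<theta>\<bar> * \<bar>w \<theta>\<bar>) \<partial>\<mu>) \<le> K * Lp_norm \<mu> (holder_conj p) w"
    if [measurable]: "w \<in> borel_measurable borel" for w
    by (rule order_trans[OF Hoelder_inequality[OF _ _ assms(12)] mult_right_mono[OF assms(14)]])
       auto
  have diff: "\<bar>?g \<theta> - exp (- \<Phi> \<theta>) / Zt \<theta>\<bar> = \<bar>?g \<theta>\<bar> * \<bar>Z \<theta> / Zt \<theta> - 1\<bar>" for \<theta>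
  proof -
    have "?g \<theta> - exp (- \<Phi> \<theta>) / Zt \<theta> = - (?g \<theta> * (Z \<theta> / Zt \<theta> - 1))"
      using assms(5)[of \<theta>] assms(7)[of \<theta>] by (simp add: right_diff_distrib)
    then show ?thesis
      by (simp only: abs_minus_cancel abs_mult)
  qed

  show "tv_dist (posterior \<mu> \<Phi> Z) (posterior \<mu> \<Phi> Zt)
      \<le> 2 * K / ?C * Lp_norm \<mu> (holder_conj p) (\<lambda>\<theta>. Z \<theta> / Zt \<theta> - 1)"
  proof -
    have "tv_dist (posterior \<mu> \<Phi> Z) (posterior \<mu> \<Phi> Zt)
        \<le> 2 / ?C * (\<integral>\<^sup>+ \<theta>. ennreal (\<bar>?g \<theta>\<bar> * \<bar>Z \<theta> / Zt \<theta> - 1\<bar>) \<partial>\<mu>)"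
      using tv unfolding diff .
    also have "\<dots> \<le> 2 / ?C * (K * Lp_norm \<mu> (holder_conj p) (\<lambda>\<theta>. Z \<theta> / Zt \<theta> - 1))"
      by (intro mult_left_mono Hoelder) auto
    finally show ?thesis
      by (simp add: divide_ennreal_def mult_ac)
  qed

  fix l :: real
  assume l: "0 < l \<and> l \<le> (INF \<theta>. Zt \<theta>)"
  have "bdd_below (range Zt)"
    using assms(7) by (intro bdd_belowI[of _ 0]) (auto simp: less_imp_le)
  then have Zt_ge: "l \<le> Zt \<theta>" for \<theta>
    using l cINF_lower[of Zt UNIV \<theta>] by force
  have "\<bar>Z \<theta> / Zt \<theta> - 1\<bar> \<le> 1 / l * \<bar>Z \<theta> - Zt \<theta>\<bar>" for \<theta>
  proof -
    have "\<bar>Z \<theta> / Zt \<theta> - 1\<bar> = \<bar>Z \<theta> - Zt \<theta>\<bar> / Zt \<theta>"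
      using assms(7)[of \<theta>] abs_divide[of "Z \<theta> - Zt \<theta>" "Zt \<theta>"] by (simp add: diff_divide_distrib)
    also have "\<dots> \<le> \<bar>Z \<theta> - Zt \<theta>\<bar> / l"
      using Zt_ge[of \<theta>] l by (intro divide_left_mono) auto
    finally show ?thesis by simp
  qed
  then have "\<bar>?g \<theta>\<bar> * \<bar>Z \<theta> / Zt \<theta> - 1\<bar> \<le> 1 / l * (\<bar>?g \<theta>\<bar> * \<bar>Z \<theta> - Zt \<theta>\<bar>)" for \<theta>
    using mult_left_mono[of "\<bar>Z \<theta> / Zt \<theta> - 1\<bar>" "1 / l * \<bar>Z \<theta> - Zt \<theta>\<bar>" "\<bar>?g \<theta>\<bar>"]
    by (simp add: mult_ac)
  then have "tv_dist (posterior \<mu> \<Phi> Z) (posterior \<mu> \<Phi> Zt)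
      \<le> 2 / ?C * (\<integral>\<^sup>+ \<theta>. ennreal (1 / l) * ennreal (\<bar>?g \<theta>\<bar> * \<bar>Z \<theta> - Zt \<theta>\<bar>) \<partial>\<mu>)"
    using l by (intro order_trans[OF tv[unfolded diff]] mult_left_mono nn_integral_mono)
      (simp_all flip: ennreal_mult)
  also have "\<dots> = 2 / ?C * (ennreal (1 / l) * (\<integral>\<^sup>+ \<theta>. ennreal (\<bar>?g \<theta>\<bar> * \<bar>Z \<theta> - Zt \<theta>\<bar>) \<partial>\<mu>))"
    by (subst nn_integral_cmult) auto
  also have "\<dots> \<le> 2 / ?C * (ennreal (1 / l) * (K * Lp_norm \<mu> (holder_conj p) (\<lambda>\<theta>. Z \<theta> - Zt \<theta>)))"
    by (intro mult_left_mono Hoelder) auto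
  also have "\<dots> = 2 * K / (ennreal l * ?C) * Lp_norm \<mu> (holder_conj p) (\<lambda>\<theta>. Z \<theta> - Zt \<theta>)"
  proof -
    have "inverse (ennreal l * ?C) = ennreal (1 / l) * inverse ?C"
      using l assms(8,9)
      by (subst ennreal_inverse_mult) (auto simp: inverse_ennreal inverse_eq_divide)
    then show ?thesis
      by (simp add: divide_ennreal_def mult_ac)
  qed
  finally show "tv_dist (posterior \<mu> \<Phi> Z) (posterior \<mu> \<Phi> Zt)
      \<le> 2 * K / (ennreal l * ?C) * Lp_norm \<mu> (holder_conj p) (\<lambda>\<theta>. Z \<theta> - Zt \<theta>)" .
qed

end
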